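(* Fix $n=3$, $(p_1,p_2,p_3)=(0,1,2)$, $\beta=1$ and $\omega=\pi$. Along the phase flow $\dot\theta_i=\sum_jA_{ij}(\theta)\sin(\theta_j-\theta_i)$, the time derivative of the energy $$E_+(\theta)=\sum_{i,j=1}^{n}e^{\beta\cos\delta_{ij}},\qquad \delta_{ij}=\theta_i-\theta_j+\omega(p_i-p_j),$$ satisfies $$\left.\frac{d}{dt}E_+\right|_{\theta=(0,\pi/6,\pi/3)}>0,\qquad \left.\frac{d}{dt}E_+\right|_{\theta=(0,\pi/6,0)}<0 .$$ Consequently, for this fixed system, neither $E_+$ nor $-E_+$ is a Lyapunov function (i.e. neither is monotone non-increasing along all trajectories). In particular, the energy form $E_+$ has no monotonicity law of either sign (always non-decreasing along trajectories, or always non-increasing along trajectories) that holds uniformly over all systems given by parameters $n,\beta,\omega,(p_i)$.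
   Context: RoPE self-attention on the circle with a single frequency: for $n\ge 2$, finite $\beta\ge 0$, positions $p_1,\dots,p_n\in\mathbb{R}$, frequency $\omega\in\mathbb{R}$ and phases $\theta=(\theta_1,\dots,\theta_n)$, put $\delta_{ij}=\theta_i-\theta_j+\omega(p_i-p_j)$, $W_{ij}(\theta)=e^{\beta\cos\delta_{ij}}$, $Z_i=\sum_kW_{ik}$, $A_{ij}=W_{ij}/Z_i$. The phase flow is $\dot\theta_i=\sum_{j=1}^nA_{ij}(\theta)\sin(\theta_j-\theta_i)$. The derivative $\frac{d}{dt}E_+|_{\theta}$ denotes the derivative of $E_+$ along this flow at the state $\theta$, i.e. $\sum_i\frac{\partial E_+}{\partial\theta_i}\dot\theta_i$. *)

theory Defs
  imports "HOL-Analysis.Analysis"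
begin

text \<open>
  A system is given by \<^term>\<open>n\<close>, \<^term>\<open>\<beta>\<close>, \<^term>\<open>\<omega>\<close> and the positions
  \<^term>\<open>p\<close>. Positions and phases are functions on \<^typ>\<open>nat\<close> of which only the entries with
  index in \<^term>\<open>{1..n}\<close> matter; this allows quantification over \<^term>\<open>n\<close>.
\<close>

definition phase_diff :: "real \<Rightarrow> (nat \<Rightarrow> real) \<Rightarrow> (nat \<Rightarrow> real) \<Rightarrow> nat \<Rightarrow> nat \<Rightarrow> real" where
  "phase_diff \<omega> p \<theta> i j = \<theta> i - \<theta> j + \<omega> * (p i - p j)"

definition weight :: "real \<Rightarrow> real \<Rightarrow> (nat \<Rightarrow> real) \<Rightarrow> (nat \<Rightarrow> real) \<Rightarrow> nat \<Rightarrow> nat \<Rightarrow> real" where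
  "weight \<beta> \<omega> p \<theta> i j = exp (\<beta> * cos (phase_diff \<omega> p \<theta> i j))"

definition partition_fn :: "nat \<Rightarrow> real \<Rightarrow> real \<Rightarrow> (nat \<Rightarrow> real) \<Rightarrow> (nat \<Rightarrow> real) \<Rightarrow> nat \<Rightarrow> real" where
  "partition_fn n \<beta> \<omega> p \<theta> i = (\<Sum>k=1..n. weight \<beta> \<omega> p \<theta> i k)"

definition attention ::
    "nat \<Rightarrow> real \<Rightarrow> real \<Rightarrow> (nat \<Rightarrow> real) \<Rightarrow> (nat \<Rightarrow> real) \<Rightarrow> nat \<Rightarrow> nat \<Rightarrow> real" where
  "attention n \<beta> \<omega> p \<theta> i j = weight \<beta> \<omega> p \<theta> i j / partition_fn n \<beta> \<omega> p \<theta> i"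

definition phase_field ::
    "nat \<Rightarrow> real \<Rightarrow> real \<Rightarrow> (nat \<Rightarrow> real) \<Rightarrow> (nat \<Rightarrow> real) \<Rightarrow> nat \<Rightarrow> real" where
  "phase_field n \<beta> \<omega> p \<theta> i = (\<Sum>j=1..n. attention n \<beta> \<omega> p \<theta> i j * sin (\<theta> j - \<theta> i))"

definition energy :: "nat \<Rightarrow> real \<Rightarrow> real \<Rightarrow> (nat \<Rightarrow> real) \<Rightarrow> (nat \<Rightarrow> real) \<Rightarrow> real" where
  "energy n \<beta> \<omega> p \<theta> = (\<Sum>i=1..n. \<Sum>j=1..n. exp (\<beta> * cos (phase_diff \<omega> p \<theta> i j)))"

definition partial_deriv :: "((nat \<Rightarrow> real) \<Rightarrow> real) \<Rightarrow> (nat \<Rightarrow> real) \<Rightarrow> nat \<Rightarrow> real" where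
  "partial_deriv V \<theta> i = deriv (\<lambda>s. V (\<theta>(i := s))) (\<theta> i)"

definition flow_deriv ::
    "nat \<Rightarrow> real \<Rightarrow> real \<Rightarrow> (nat \<Rightarrow> real) \<Rightarrow> ((nat \<Rightarrow> real) \<Rightarrow> real) \<Rightarrow> (nat \<Rightarrow> real) \<Rightarrow> real" where
  "flow_deriv n \<beta> \<omega> p V \<theta> = (\<Sum>i=1..n. partial_deriv V \<theta> i * phase_field n \<beta> \<omega> p \<theta> i)"

text \<open>
  The vector field is bounded and smooth, so every solution extends to all times; trajectories
  are therefore taken to be defined on the whole real line.
\<close>

definition trajectory ::
    "nat \<Rightarrow> real \<Rightarrow> real \<Rightarrow> (nat \<Rightarrow> real) \<Rightarrow> (real \<Rightarrow> nat \<Rightarrow> real) \<Rightarrow> bool" where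
  "trajectory n \<beta> \<omega> p x \<longleftrightarrow>
     (\<forall>t. \<forall>i\<in>{1..n}. ((\<lambda>s. x s i) has_real_derivative phase_field n \<beta> \<omega> p (x t) i) (at t))"

definition nonincreasing_along ::
    "nat \<Rightarrow> real \<Rightarrow> real \<Rightarrow> (nat \<Rightarrow> real) \<Rightarrow> ((nat \<Rightarrow> real) \<Rightarrow> real) \<Rightarrow> bool" where
  "nonincreasing_along n \<beta> \<omega> p V \<longleftrightarrow>
     (\<forall>x. trajectory n \<beta> \<omega> p x \<longrightarrow> antimono (\<lambda>t. V (x t)))"

definition nondecreasing_along ::
    "nat \<Rightarrow> real \<Rightarrow> real \<Rightarrow> (nat \<Rightarrow> real) \<Rightarrow> ((nat \<Rightarrow> real) \<Rightarrow> real) \<Rightarrow> bool" where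
  "nondecreasing_along n \<beta> \<omega> p V \<longleftrightarrow>
     (\<forall>x. trajectory n \<beta> \<omega> p x \<longrightarrow> mono (\<lambda>t. V (x t)))"

text \<open>``Lyapunov function'' is meant in the weak sense: no definiteness is required.\<close>

definition lyapunov_function ::
    "nat \<Rightarrow> real \<Rightarrow> real \<Rightarrow> (nat \<Rightarrow> real) \<Rightarrow> ((nat \<Rightarrow> real) \<Rightarrow> real) \<Rightarrow> bool" where
  "lyapunov_function n \<beta> \<omega> p V \<longleftrightarrow> nonincreasing_along n \<beta> \<omega> p V"

text \<open>The vector \<open>(a, b, c)\<close>, indexed by \<^term>\<open>{1..3}\<close>.\<close>

definition triple :: "real \<Rightarrow> real \<Rightarrow> real \<Rightarrow> nat \<Rightarrow> real" where
  "triple a b c = (\<lambda>_. 0)(1 := a, 2 := b, 3 := c)"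

end

theory Submission
  imports Defs "HOL-Probability.Discrete_Topology"
begin

text \<open>
  By the chain rule, the derivative of \<open>E\<^sub>+\<close> along the flow is a sum over pairs,
  \<open>\<Sum>\<^sub>i\<^sub>j W\<^sub>i\<^sub>j (- \<beta> sin \<delta>\<^sub>i\<^sub>j) (v\<^sub>i - v\<^sub>j)\<close>, where \<open>v\<close> is the phase velocity
  (\<open>flow_deriv_energy\<close>). For \<open>\<omega> = pi\<close> and positions 0, 1, 2 the rotation reverses the sign of
  \<open>cos\<close> and \<open>sin\<close> of the phase difference between neighbours and keeps it between the two outer
  tokens. So between neighbours the attraction of the flow works against the energy, and between
  the outer tokens it works for it. Each of the two states lets one effect win, and symmetry
  makes this visible without numerical estimates: both states are invariant under exchanging the
  outer tokens, the first one in combination with reflecting all phases. Write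
  \<open>a = exp (- sqrt 3 / 2)\<close> for the weight between neighbours.

  \<^item> At \<open>(0, pi/6, pi/3)\<close> the middle token is at rest, the outer ones approach it with equal speed
    \<open>v\<^sub>1 > 0\<close>, and with \<open>b = exp (1/2)\<close> the derivative is \<open>2 v\<^sub>1 (sqrt 3 b - a)\<close>. It is positive
    since \<open>a < 1 < b\<close>.
  \<^item> At \<open>(0, pi/6, 0)\<close> the outer tokens coincide and move up with the same velocity \<open>v\<^sub>1 > 0\<close>, the
    middle one moves down with \<open>v\<^sub>2 < 0\<close>, and the derivative is \<open>2 a (v\<^sub>2 - v\<^sub>1) < 0\<close>.

  A sign of the derivative at a state refutes monotonicity along trajectories only if some
  trajectory, defined for all times, passes through that state. This existence statement
  (\<open>trajectory_exists\<close>) takes up most of the work: \<open>global_solution_of_Lipschitz_ODE\<close> is a global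
  Picard-Lindelof theorem in a Banach space, and the phase field is Lipschitz because it is built
  from bounded Lipschitz functions by operations that preserve this class. The energy along the
  trajectory then has a nonzero derivative at time 0, so it moves strictly in that direction right
  after time 0. The fixed system also serves as the counterexample to both uniform laws.
\<close>

section \<open>Global solutions of Lipschitz differential equations\<close>

text \<open>
  The integral from 0 to \<open>t\<close> for \<open>t\<close> of either sign: one of the two intervals is always empty or a
  point. This lets the Picard operator solve forwards and backwards in time at once.
\<close>
definition oriented_integral :: "(real \<Rightarrow> 'a::banach) \<Rightarrow> real \<Rightarrow> 'a" where
  "oriented_integral g t = integral {0..t} g - integral {t..0} g"

lemma oriented_integral_has_vector_derivative:
  fixes g :: "real \<Rightarrow> 'a::banach"
  assumes g: "continuous_on UNIV g"
  shows "(oriented_integral g has_vector_derivative g t) (at t)"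
proof -
  define T where "T = \<bar>t\<bar> + 1"
  have int: "g integrable_on {a..b}" for a b
    using g by (intro integrable_continuous_real) (auto intro: continuous_on_subset)
  have t: "t \<in> {-T<..<T}" by (auto simp: T_def)
  \<comment> \<open>Near \<open>t\<close>, moving the base point to the left of everything turns the oriented integral into
    an ordinary one up to a constant.\<close>
  have eq: "integral {-T..s} g - integral {-T..0} g = oriented_integral g s"
    if "s \<in> {-T<..<T}" for s
  proof (cases "s \<ge> 0")
    case True
    have "integral {s..0} g = 0" using True by (cases "s = 0") auto
    moreover have "integral {-T..0} g + integral {0..s} g = integral {-T..s} g"
      using True int by (intro Henstock_Kurzweil_Integration.integral_combine) (auto simp: T_def)
    ultimately show ?thesis by (simp add: oriented_integral_def algebra_simps)
  next
    case False
    have "integral {-T..s} g + integral {s..0} g = integral {-T..0} g"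
      using False int that by (intro Henstock_Kurzweil_Integration.integral_combine) auto
    with False show ?thesis by (simp add: oriented_integral_def algebra_simps)
  qed
  have "((\<lambda>s. integral {-T..s} g) has_vector_derivative g t) (at t within {-T..T})"
    using g t by (intro integral_has_vector_derivative) (auto intro: continuous_on_subset)
  then have "((\<lambda>s. integral {-T..s} g) has_vector_derivative g t) (at t within {-T<..<T})"
    by (rule has_vector_derivative_within_subset) auto
  then have "((\<lambda>s. integral {-T..s} g) has_vector_derivative g t) (at t)"
    by (simp only: at_within_open[OF t open_greaterThanLessThan])
  then have "((\<lambda>s. integral {-T..s} g - integral {-T..0} g) has_vector_derivative g t) (at t)"
    by (auto intro!: derivative_eq_intros)
  then show ?thesis
    by (rule has_vector_derivative_transform_within_open[OF _ _ t]) (auto simp: eq)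
qed

lemma oriented_integral_diff:
  fixes g h :: "real \<Rightarrow> 'a::banach"
  assumes "continuous_on UNIV g" "continuous_on UNIV h"
  shows "oriented_integral g t - oriented_integral h t = oriented_integral (\<lambda>s. g s - h s) t"
proof -
  have "g integrable_on {a..b}" "h integrable_on {a..b}" for a b
    using assms by (auto intro!: integrable_continuous_real intro: continuous_on_subset)
  then show ?thesis
    by (simp add: oriented_integral_def Henstock_Kurzweil_Integration.integral_diff)
qed

text \<open>
  Integrating a function of exponential growth gains the factor \<open>1 / \<kappa>\<close>. This is what makes the
  Picard operator a contraction in a weighted norm, however large the Lipschitz constant is.
\<close>
lemma norm_oriented_integral_le:
  fixes g :: "real \<Rightarrow> 'a::banach"
  assumes g: "continuous_on UNIV g" and "\<kappa> > 0" "C \<ge> 0"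
    and le: "\<And>s. norm (g s) \<le> C * exp (\<kappa> * \<bar>s\<bar>)"
  shows "norm (oriented_integral g t) \<le> C / \<kappa> * exp (\<kappa> * \<bar>t\<bar>)"
proof -
  have int: "g integrable_on {a..b}" for a b
    using g by (intro integrable_continuous_real) (auto intro: continuous_on_subset)
  show ?thesis
  proof (cases "t \<ge> 0")
    case True
    have "((\<lambda>s. C * exp (\<kappa> * s)) has_integral C / \<kappa> * exp (\<kappa> * t) - C / \<kappa> * exp (\<kappa> * 0)) {0..t}"
      using True \<open>\<kappa> > 0\<close>
      by (intro fundamental_theorem_of_calculus)
         (auto intro!: derivative_eq_intros simp flip: has_real_derivative_iff_has_vector_derivative)
    moreover have "norm (integral {0..t} g) \<le> integral {0..t} (\<lambda>s. C * exp (\<kappa> * s))"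
      using calculation le int
      by (intro Henstock_Kurzweil_Integration.integral_norm_bound_integral)
         (auto simp: integrable_on_def, metis abs_of_nonneg)
    ultimately have "norm (integral {0..t} g) \<le> C / \<kappa> * exp (\<kappa> * t) - C / \<kappa> * exp (\<kappa> * 0)"
      by (simp only: integral_unique)
    also have "\<dots> \<le> C / \<kappa> * exp (\<kappa> * t)" using \<open>\<kappa> > 0\<close> \<open>C \<ge> 0\<close> by simp
    moreover have "integral {t..0} g = 0" using True by (cases "t = 0") auto
    ultimately show ?thesis using True by (simp add: oriented_integral_def)
  next
    case False
    have "((\<lambda>s. C * exp (- (\<kappa> * s))) has_integral
        - (C / \<kappa>) * exp (- (\<kappa> * 0)) - (- (C / \<kappa>) * exp (- (\<kappa> * t)))) {t..0}"
      using False \<open>\<kappa> > 0\<close>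
      by (intro fundamental_theorem_of_calculus)
         (auto intro!: derivative_eq_intros simp flip: has_real_derivative_iff_has_vector_derivative)
    moreover have "norm (integral {t..0} g) \<le> integral {t..0} (\<lambda>s. C * exp (- (\<kappa> * s)))"
    proof (rule Henstock_Kurzweil_Integration.integral_norm_bound_integral)
      show "norm (g s) \<le> C * exp (- (\<kappa> * s))" if "s \<in> {t..0}" for s
        using le[of s] that by simp
    qed (use calculation int in \<open>auto simp: integrable_on_def\<close>)
    ultimately have "norm (integral {t..0} g)
        \<le> - (C / \<kappa>) * exp (- (\<kappa> * 0)) - (- (C / \<kappa>) * exp (- (\<kappa> * t)))"
      by (simp only: integral_unique)
    also have "\<dots> \<le> C / \<kappa> * exp (- (\<kappa> * t))" using \<open>\<kappa> > 0\<close> \<open>C \<ge> 0\<close> by simp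
    finally show ?thesis using False by (simp add: oriented_integral_def)
  qed
qed

text \<open>
  Bielecki's form of the Picard-Lindelof argument. A solution is sought as
  \<open>x t = x0 + exp (\<kappa> \<bar>t\<bar>) z t\<close> with \<open>z\<close> bounded and continuous on the whole line. With \<open>\<kappa>\<close> twice the
  Lipschitz constant, the integral equation for \<open>z\<close> is a fixed point equation for a contraction, so
  a single application of Banach's theorem yields a solution for all times and no local solutions
  have to be glued.
\<close>
theorem global_solution_of_Lipschitz_ODE:
  fixes f :: "'a::banach \<Rightarrow> 'a"
  assumes "L-lipschitz_on UNIV f"
  obtains x where "x 0 = x0" "\<And>t. (x has_vector_derivative f (x t)) (at t)"
proof -
  \<comment> \<open>Adding 1 makes the Lipschitz constant positive, since \<open>\<kappa>\<close> has to be.\<close>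
  define K where "K = L + 1"
  have "K > 0" using lipschitz_on_nonneg[OF assms] by (simp add: K_def)
  have "K-lipschitz_on UNIV f" using assms by (rule lipschitz_on_mono) (auto simp: K_def)
  then have lip: "norm (f x - f y) \<le> K * norm (x - y)" for x y
    by (auto simp: lipschitz_on_def dist_norm)
  have contf: "continuous_on A f" for A
    using lipschitz_on_continuous_on[OF assms] continuous_on_subset by blast
  define \<kappa> where "\<kappa> = 2 * K"
  have "\<kappa> > 0" using \<open>K > 0\<close> by (simp add: \<kappa>_def)
  define curve where "curve z s = x0 + exp (\<kappa> * \<bar>s\<bar>) *\<^sub>R apply_bcontfun z s"
    for z :: "real \<Rightarrow>\<^sub>C 'a" and s
  define \<Phi> where "\<Phi> z t = exp (- (\<kappa> * \<bar>t\<bar>)) *\<^sub>R oriented_integral (\<lambda>s. f (curve z s)) t" for z t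
  have cont: "continuous_on UNIV (\<lambda>s. f (curve z s))" for z
    unfolding curve_def by (rule continuous_on_compose2[OF contf]) (auto intro!: continuous_intros)
  have "continuous_on UNIV (oriented_integral (\<lambda>s. f (curve z s)))" for z
    using oriented_integral_has_vector_derivative[OF cont]
    by (meson continuous_at_imp_continuous_on has_vector_derivative_continuous)
  then have cont\<Phi>: "continuous_on UNIV (\<Phi> z)" for z
    unfolding \<Phi>_def by (intro continuous_intros) auto
  have weighted: "norm (exp (- (\<kappa> * \<bar>t\<bar>)) *\<^sub>R v) \<le> C" if "norm v \<le> C * exp (\<kappa> * \<bar>t\<bar>)"
    for t C and v :: 'a
    using that by (simp add: exp_minus field_simps)
  have "norm (\<Phi> z t) \<le> (norm (f x0) + K * norm z) / \<kappa>" for z t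
    unfolding \<Phi>_def
  proof (rule weighted, rule norm_oriented_integral_le[OF cont \<open>\<kappa> > 0\<close>])
    fix s
    have "norm (f (curve z s)) \<le> norm (f x0) + K * norm (curve z s - x0)"
      using lip[of "curve z s" x0] norm_triangle_ineq2[of "f (curve z s)" "f x0"] by linarith
    also have "K * norm (curve z s - x0) \<le> K * (exp (\<kappa> * \<bar>s\<bar>) * norm z)"
      using \<open>K > 0\<close> by (simp add: curve_def norm_bounded)
    also have "norm (f x0) \<le> norm (f x0) * exp (\<kappa> * \<bar>s\<bar>)"
      using \<open>\<kappa> > 0\<close> by (simp add: mult_le_cancel_left1)
    finally show "norm (f (curve z s)) \<le> (norm (f x0) + K * norm z) * exp (\<kappa> * \<bar>s\<bar>)"
      by (simp add: algebra_simps)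
  qed (use \<open>K > 0\<close> in simp)
  then have mem: "\<Phi> z \<in> bcontfun" for z
    by (intro bcontfun_normI[OF cont\<Phi>])
  have contraction: "dist (Bcontfun (\<Phi> y)) (Bcontfun (\<Phi> z)) \<le> 1/2 * dist y z" for y z
  proof (rule dist_bound)
    fix t
    have "norm (f (curve y s) - f (curve z s)) \<le> (K * dist y z) * exp (\<kappa> * \<bar>s\<bar>)" for s
    proof -
      have "norm (f (curve y s) - f (curve z s)) \<le> K * norm (curve y s - curve z s)"
        by (rule lip)
      also have "norm (curve y s - curve z s) = exp (\<kappa> * \<bar>s\<bar>) * dist (y s) (z s)"
        by (simp add: curve_def dist_norm flip: scaleR_diff_right)
      also have "dist (y s) (z s) \<le> dist y z" by (rule dist_bounded)
      finally show ?thesis using \<open>K > 0\<close> by (simp add: mult_ac)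
    qed
    then have "norm (oriented_integral (\<lambda>s. f (curve y s) - f (curve z s)) t)
        \<le> K * dist y z / \<kappa> * exp (\<kappa> * \<bar>t\<bar>)"
      using \<open>\<kappa> > 0\<close> \<open>K > 0\<close> by (intro norm_oriented_integral_le continuous_intros cont) auto
    then have "norm (\<Phi> y t - \<Phi> z t) \<le> K * dist y z / \<kappa>"
      unfolding \<Phi>_def scaleR_diff_right[symmetric] oriented_integral_diff[OF cont cont]
      by (rule weighted)
    then show "dist (Bcontfun (\<Phi> y) t) (Bcontfun (\<Phi> z) t) \<le> 1/2 * dist y z"
      using \<open>K > 0\<close> by (simp add: Bcontfun_inverse mem dist_norm \<kappa>_def)
  qed
  then obtain z where "Bcontfun (\<Phi> z) = z"
    using banach_fix_type[of "1/2" "\<lambda>z. Bcontfun (\<Phi> z)"] by auto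
  then have "apply_bcontfun z t = \<Phi> z t" for t
    by (metis Bcontfun_inverse mem)
  then have "curve z t = x0 + oriented_integral (\<lambda>s. f (curve z s)) t" for t
    unfolding curve_def[of z t] by (simp add: \<Phi>_def exp_minus)
  then have fp: "curve z = (\<lambda>t. x0 + oriented_integral (\<lambda>s. f (curve z s)) t)" by blast
  show thesis
  proof
    show "curve z 0 = x0" by (subst fp) (simp add: oriented_integral_def)
    show "(curve z has_vector_derivative f (curve z t)) (at t)" for t
      by (subst fp) (auto intro!: derivative_eq_intros oriented_integral_has_vector_derivative[OF cont])
  qed
qed

section \<open>The phase field is Lipschitz\<close>

text \<open>
  Boundedness is part of the notion because products and exponentials of unbounded Lipschitz
  functions need not be Lipschitz.
\<close>
definition bounded_lipschitz :: "('a::metric_space \<Rightarrow> real) \<Rightarrow> bool" where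
  "bounded_lipschitz f \<longleftrightarrow> bounded (range f) \<and> (\<exists>L. L-lipschitz_on UNIV f)"

lemma bounded_lipschitzE:
  assumes "bounded_lipschitz f"
  obtains B L where "B \<ge> 0" "L \<ge> 0" "\<And>x. \<bar>f x\<bar> \<le> B" "\<And>x y. \<bar>f x - f y\<bar> \<le> L * dist x y"
proof -
  obtain B where "\<And>x. \<bar>f x\<bar> \<le> B"
    using assms by (auto simp: bounded_lipschitz_def bounded_iff)
  moreover from this have "B \<ge> 0" by (meson abs_ge_zero order_trans)
  moreover obtain L where "L-lipschitz_on UNIV f"
    using assms by (auto simp: bounded_lipschitz_def)
  then have "L \<ge> 0" "\<And>x y. \<bar>f x - f y\<bar> \<le> L * dist x y"
    by (auto simp: lipschitz_on_def dist_real_def)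
  ultimately show thesis using that by blast
qed

lemma bounded_lipschitzI:
  assumes "L \<ge> 0" "\<And>x. \<bar>f x\<bar> \<le> B" "\<And>x y. \<bar>f x - f y\<bar> \<le> L * dist x y"
  shows "bounded_lipschitz f"
  unfolding bounded_lipschitz_def
proof
  show "bounded (range f)" using assms(2) by (auto simp: bounded_iff)
  show "\<exists>L. L-lipschitz_on UNIV f"
    using assms by (intro exI[of _ L] lipschitz_onI) (auto simp: dist_real_def)
qed

lemma bounded_lipschitz_mult:
  assumes "bounded_lipschitz f" "bounded_lipschitz g"
  shows "bounded_lipschitz (\<lambda>x. f x * g x)"
proof -
  obtain B L where f: "B \<ge> 0" "L \<ge> 0" "\<And>x. \<bar>f x\<bar> \<le> B" "\<And>x y. \<bar>f x - f y\<bar> \<le> L * dist x y"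
    using assms(1) by (rule bounded_lipschitzE) blast
  obtain B' L' where g: "B' \<ge> 0" "L' \<ge> 0" "\<And>x. \<bar>g x\<bar> \<le> B'" "\<And>x y. \<bar>g x - g y\<bar> \<le> L' * dist x y"
    using assms(2) by (rule bounded_lipschitzE) blast
  show ?thesis
  proof (rule bounded_lipschitzI)
    show "\<bar>f x * g x\<bar> \<le> B * B'" for x
      using f g by (simp add: abs_mult mult_mono)
    show "\<bar>f x * g x - f y * g y\<bar> \<le> (B * L' + L * B') * dist x y" for x y
    proof -
      have "f x * g x - f y * g y = f x * (g x - g y) + (f x - f y) * g y"
        by (simp add: algebra_simps)
      then have "\<bar>f x * g x - f y * g y\<bar> \<le> \<bar>f x\<bar> * \<bar>g x - g y\<bar> + \<bar>f x - f y\<bar> * \<bar>g y\<bar>"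
        by (metis abs_mult abs_triangle_ineq)
      also have "\<dots> \<le> B * (L' * dist x y) + (L * dist x y) * B'"
        using f g by (intro add_mono mult_mono) auto
      finally show ?thesis by (simp add: algebra_simps)
    qed
  qed (use f g in simp)
qed

lemma bounded_lipschitz_sum:
  assumes "\<And>i. i \<in> I \<Longrightarrow> bounded_lipschitz (f i)"
  shows "bounded_lipschitz (\<lambda>x. \<Sum>i\<in>I. f i x)"
  using assms
proof (induction I rule: infinite_finite_induct)
  case (insert i I)
  obtain B L where f: "B \<ge> 0" "L \<ge> 0" "\<And>x. \<bar>f i x\<bar> \<le> B"
      "\<And>x y. \<bar>f i x - f i y\<bar> \<le> L * dist x y"
    using insert.prems by (meson bounded_lipschitzE insertI1)
  let ?S = "\<lambda>x. \<Sum>i\<in>I. f i x"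
  have "bounded_lipschitz ?S" using insert by simp
  then obtain B' L' where g: "B' \<ge> 0" "L' \<ge> 0" "\<And>x. \<bar>?S x\<bar> \<le> B'"
      "\<And>x y. \<bar>?S x - ?S y\<bar> \<le> L' * dist x y"
    by (rule bounded_lipschitzE) blast
  have "bounded_lipschitz (\<lambda>x. f i x + ?S x)"
  proof (rule bounded_lipschitzI)
    show "\<bar>f i x + ?S x\<bar> \<le> B + B'" for x using f(3)[of x] g(3)[of x] by linarith
    show "\<bar>f i x + ?S x - (f i y + ?S y)\<bar> \<le> (L + L') * dist x y" for x y
      using f(4)[of x y] g(4)[of x y] unfolding distrib_right by linarith
  qed (use f g in simp)
  then show ?case using insert by simp
qed (auto intro: bounded_lipschitzI[of 0 _ 0])

lemma bounded_lipschitz_exp: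
  assumes "bounded_lipschitz f"
  shows "bounded_lipschitz (\<lambda>x. exp (f x))"
proof -
  obtain B L where f: "B \<ge> 0" "L \<ge> 0" "\<And>x. \<bar>f x\<bar> \<le> B" "\<And>x y. \<bar>f x - f y\<bar> \<le> L * dist x y"
    using assms by (rule bounded_lipschitzE) blast
  \<comment> \<open>The tangent of \<open>exp\<close> at the larger argument lies below the graph.\<close>
  have exp_lip: "\<bar>exp a - exp b\<bar> \<le> exp B * \<bar>a - b\<bar>" if "a \<le> B" "b \<le> B" for a b :: real
    using that
  proof (induction a b rule: linorder_wlog)
    case (le a b)
    have "exp b * (1 + (a - b)) \<le> exp b * exp (a - b)"
      by (intro mult_left_mono exp_ge_add_one_self) simp
    then have "exp b - exp a \<le> exp b * (b - a)"
      by (simp add: algebra_simps flip: exp_add)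
    also have "\<dots> \<le> exp B * (b - a)" using le by (intro mult_right_mono) auto
    finally show ?case using le by simp
  qed (simp add: abs_minus_commute)
  show ?thesis
  proof (rule bounded_lipschitzI)
    have le: "f x \<le> B" for x using f(3)[of x] by simp
    then show "\<bar>exp (f x)\<bar> \<le> exp B" for x by simp
    show "\<bar>exp (f x) - exp (f y)\<bar> \<le> (exp B * L) * dist x y" for x y
    proof -
      have "\<bar>exp (f x) - exp (f y)\<bar> \<le> exp B * \<bar>f x - f y\<bar>" using le by (intro exp_lip)
      also have "\<dots> \<le> exp B * (L * dist x y)" using f by simp
      finally show ?thesis by (simp add: mult.assoc)
    qed
  qed (use f in simp)
qed

lemma bounded_lipschitz_inverse:
  assumes "bounded_lipschitz f" "c > 0" "\<And>x. f x \<ge> c"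
  shows "bounded_lipschitz (\<lambda>x. inverse (f x))"
proof -
  obtain B L where f: "B \<ge> 0" "L \<ge> 0" "\<And>x. \<bar>f x\<bar> \<le> B" "\<And>x y. \<bar>f x - f y\<bar> \<le> L * dist x y"
    using assms(1) by (rule bounded_lipschitzE) blast
  have pos: "f x > 0" for x using assms(2,3) by (rule less_le_trans)
  have inv_le: "\<bar>inverse (f x)\<bar> \<le> inverse c" for x
    using assms pos[of x] by (simp add: le_imp_inverse_le)
  show ?thesis
  proof (rule bounded_lipschitzI)
    show "\<bar>inverse (f x) - inverse (f y)\<bar> \<le> (inverse c * L * inverse c) * dist x y" for x y
    proof -
      have "inverse (f x) - inverse (f y) = - (inverse (f x) * (f x - f y) * inverse (f y))"
        using pos[of x] pos[of y] by (intro inverse_diff_inverse) auto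
      then have "\<bar>inverse (f x) - inverse (f y)\<bar>
          = \<bar>inverse (f x)\<bar> * \<bar>f x - f y\<bar> * \<bar>inverse (f y)\<bar>"
        by (simp only: abs_minus_cancel abs_mult)
      also have "\<dots> \<le> inverse c * (L * dist x y) * inverse c"
        using f assms inv_le by (intro mult_mono) auto
      finally show ?thesis by (simp add: mult_ac)
    qed
  qed (use inv_le f assms in auto)
qed

lemma bounded_lipschitz_sin:
  assumes "L-lipschitz_on UNIV f"
  shows "bounded_lipschitz (\<lambda>x. sin (f x :: real))"
proof (rule bounded_lipschitzI)
  show "L \<ge> 0" using assms by (rule lipschitz_on_nonneg)
  show "\<bar>sin (f x)\<bar> \<le> 1" for x by simp
  have "\<bar>sin a - sin b\<bar> \<le> \<bar>a - b\<bar>" for a b :: real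
  proof -
    have "\<bar>sin a - sin b\<bar> = 2 * \<bar>sin ((a - b) / 2)\<bar> * \<bar>cos ((a + b) / 2)\<bar>"
      by (simp add: sin_diff_sin abs_mult)
    also have "\<dots> \<le> 2 * \<bar>(a - b) / 2\<bar> * 1"
      by (intro mult_mono abs_sin_x_le_abs_x) auto
    finally show ?thesis by simp
  qed
  moreover have "\<bar>f x - f y\<bar> \<le> L * dist x y" for x y
    using assms by (auto simp: lipschitz_on_def dist_real_def)
  ultimately show "\<bar>sin (f x) - sin (f y)\<bar> \<le> L * dist x y" for x y
    by (meson order_trans)
qed

text \<open>
  The state of the system is recorded as the displacement \<open>z\<close> from a reference state \<open>\<theta>\<close>, in the
  Banach space of bounded sequences with the supremum norm. It is encoded as the bounded
  continuous functions on the naturals with the discrete metric. In this way the number of tokens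
  remains a variable. The denominators are harmless: the diagonal term already bounds the
  partition function below by \<open>exp (- \<bar>\<beta>\<bar>)\<close>.
\<close>
lemma bounded_lipschitz_phase_field:
  fixes \<theta> :: "nat \<Rightarrow> real"
  assumes i: "i \<in> {1..n}"
  shows "bounded_lipschitz (\<lambda>z :: nat discrete \<Rightarrow>\<^sub>C real. phase_field n \<beta> \<omega> p (\<lambda>j. \<theta> j + z (discrete j)) i)"
proof -
  have aff: "2-lipschitz_on UNIV (\<lambda>z :: nat discrete \<Rightarrow>\<^sub>C real. (\<theta> j + z (discrete j)) - (\<theta> k + z (discrete k)) + c)" for j k c
  proof (rule lipschitz_onI)
    fix y z :: "nat discrete \<Rightarrow>\<^sub>C real"
    show "dist ((\<theta> j + y (discrete j)) - (\<theta> k + y (discrete k)) + c) ((\<theta> j + z (discrete j)) - (\<theta> k + z (discrete k)) + c) \<le> 2 * dist y z"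
      using dist_bounded[of y "discrete j" z] dist_bounded[of y "discrete k" z] by (auto simp: dist_real_def)
  qed simp
  have weight: "bounded_lipschitz (\<lambda>z :: nat discrete \<Rightarrow>\<^sub>C real. weight \<beta> \<omega> p (\<lambda>j. \<theta> j + z (discrete j)) i j)" for j
  proof -
    \<comment> \<open>The cosine is a sine of the argument shifted by \<open>pi / 2\<close>.\<close>
    have "bounded_lipschitz (\<lambda>z :: nat discrete \<Rightarrow>\<^sub>C real.
        sin ((\<theta> i + z (discrete i)) - (\<theta> j + z (discrete j)) + (\<omega> * (p i - p j) + pi / 2)))"
      by (rule bounded_lipschitz_sin[OF aff])
    also have "(\<lambda>z :: nat discrete \<Rightarrow>\<^sub>C real.
          sin ((\<theta> i + z (discrete i)) - (\<theta> j + z (discrete j)) + (\<omega> * (p i - p j) + pi / 2)))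
        = (\<lambda>z. cos (phase_diff \<omega> p (\<lambda>j. \<theta> j + z (discrete j)) i j))"
      by (simp add: phase_diff_def sin_add flip: add.assoc)
    finally have "bounded_lipschitz (\<lambda>z. \<beta> * cos (phase_diff \<omega> p (\<lambda>j. \<theta> j + apply_bcontfun z (discrete j)) i j))"
      by (intro bounded_lipschitz_mult) (auto intro: bounded_lipschitzI[of 0])
    then show ?thesis unfolding weight_def by (rule bounded_lipschitz_exp)
  qed
  have "exp (- \<bar>\<beta>\<bar>) \<le> partition_fn n \<beta> \<omega> p \<theta>' i" for \<theta>'
  proof -
    have "\<bar>\<beta> * cos (phase_diff \<omega> p \<theta>' i i)\<bar> \<le> \<bar>\<beta>\<bar> * 1"
      unfolding abs_mult by (intro mult_left_mono) auto
    then have "exp (- \<bar>\<beta>\<bar>) \<le> weight \<beta> \<omega> p \<theta>' i i"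
      unfolding weight_def by simp
    also have "\<dots> \<le> partition_fn n \<beta> \<omega> p \<theta>' i"
      unfolding partition_fn_def using i by (intro member_le_sum) (auto simp: weight_def)
    finally show ?thesis .
  qed
  moreover have "bounded_lipschitz (\<lambda>z :: nat discrete \<Rightarrow>\<^sub>C real. partition_fn n \<beta> \<omega> p (\<lambda>j. \<theta> j + z (discrete j)) i)"
    unfolding partition_fn_def by (intro bounded_lipschitz_sum weight)
  ultimately have "bounded_lipschitz (\<lambda>z :: nat discrete \<Rightarrow>\<^sub>C real.
      inverse (partition_fn n \<beta> \<omega> p (\<lambda>j. \<theta> j + z (discrete j)) i))"
    by (intro bounded_lipschitz_inverse[of _ "exp (- \<bar>\<beta>\<bar>)"]) auto
  moreover have "bounded_lipschitz (\<lambda>z :: nat discrete \<Rightarrow>\<^sub>C real. sin ((\<theta> j + z (discrete j)) - (\<theta> i + z (discrete i))))" for j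
    using bounded_lipschitz_sin[OF aff[of j i 0]] by simp
  ultimately show ?thesis
    unfolding phase_field_def attention_def divide_inverse
    by (intro bounded_lipschitz_sum bounded_lipschitz_mult weight)
qed

instance bcontfun :: (metric_space, banach) banach ..

text \<open>
  The field is extended by 0 to indices outside \<open>{1..n}\<close>, so it is a bounded sequence and those
  coordinates stay fixed. Starting at displacement 0 gives a trajectory through \<open>\<theta>\<close>. The Lipschitz
  constant of the whole field in the supremum norm is bounded by the sum of the constants of its
  \<open>n\<close> coordinates.
\<close>
lemma trajectory_exists:
  obtains x where "trajectory n \<beta> \<omega> p x" "x 0 = \<theta>"
proof -
  define v where "v z i =
      (if i \<in> {1..n} then phase_field n \<beta> \<omega> p (\<lambda>j. \<theta> j + apply_bcontfun z (discrete j)) i else 0)"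
    for z :: "nat discrete \<Rightarrow>\<^sub>C real" and i
  have "\<exists>B L. L \<ge> 0 \<and> (\<forall>z. \<bar>v z i\<bar> \<le> B) \<and> (\<forall>y z. \<bar>v y i - v z i\<bar> \<le> L * dist y z)" for i
  proof (cases "i \<in> {1..n}")
    case True
    then have "bounded_lipschitz (\<lambda>z. v z i)"
      using bounded_lipschitz_phase_field[of i n \<beta> \<omega> p \<theta>] by (simp add: v_def)
    then show ?thesis by (rule bounded_lipschitzE) blast
  next
    case False
    then show ?thesis by (intro exI[of _ 0]) (auto simp: v_def)
  qed
  then obtain B L where L0: "\<And>i. L i \<ge> 0" and B: "\<And>i z. \<bar>v z i\<bar> \<le> B i"
      and L: "\<And>i y z. \<bar>v y i - v z i\<bar> \<le> L i * dist y z"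
    by metis
  have B0: "B i \<ge> 0" for i using B[of 0 i] by linarith
  define V where "V z = Bcontfun (\<lambda>d. v z (of_discrete d))" for z
  have V: "V z d = v z (of_discrete d)" for z d
  proof -
    have "(\<lambda>d. v z (of_discrete d)) \<in> bcontfun"
    proof (rule bcontfun_normI)
      show "continuous_on UNIV (\<lambda>d. v z (of_discrete d))"
        by (simp add: continuous_on_open_vimage open_discrete)
      show "norm (v z (of_discrete d)) \<le> (\<Sum>k=1..n. B k)" for d
      proof (cases "of_discrete d \<in> {1..n}")
        case True
        have "norm (v z (of_discrete d)) \<le> B (of_discrete d)" using B by simp
        also have "\<dots> \<le> (\<Sum>k=1..n. B k)" using True B0 by (intro member_le_sum) auto
        finally show ?thesis .
      next
        case False
        then have "v z (of_discrete d) = 0" by (simp only: v_def if_False)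
        then show ?thesis using B0 by (simp add: sum_nonneg)
      qed
    qed
    then show ?thesis by (simp add: V_def Bcontfun_inverse)
  qed
  have "(\<Sum>k=1..n. L k)-lipschitz_on UNIV V"
  proof (rule lipschitz_onI[OF dist_bound])
    fix y z d
    show "dist (V y d) (V z d) \<le> (\<Sum>k=1..n. L k) * dist y z"
    proof (cases "of_discrete d \<in> {1..n}")
      case True
      have "dist (V y d) (V z d) \<le> L (of_discrete d) * dist y z"
        using L by (simp add: V dist_real_def)
      also have "\<dots> \<le> (\<Sum>k=1..n. L k) * dist y z"
        using True L0 by (intro mult_right_mono member_le_sum) auto
      finally show ?thesis .
    next
      case False
      then have "V y d = V z d" by (simp only: V v_def if_False)
      then show ?thesis using L0 by (simp add: sum_nonneg)
    qed
  qed (simp add: sum_nonneg L0)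
  then obtain z where z0: "z 0 = 0" and z: "\<And>t. (z has_vector_derivative V (z t)) (at t)"
    by (rule global_solution_of_Lipschitz_ODE[where ?x0.0 = 0]) blast
  have coord: "bounded_linear (\<lambda>w :: nat discrete \<Rightarrow>\<^sub>C real. w d)" for d
    by (rule bounded_linear_intro[of _ 1]) (simp_all del: real_norm_def add: norm_bounded)
  show thesis
  proof
    show "trajectory n \<beta> \<omega> p (\<lambda>t i. \<theta> i + z t (discrete i))"
      unfolding trajectory_def
    proof (intro allI ballI)
      fix t i assume i: "i \<in> {1..n}"
      have "((\<lambda>s. z s (discrete i)) has_vector_derivative V (z t) (discrete i)) (at t)"
        by (rule bounded_linear.has_vector_derivative[OF coord z])
      also have "V (z t) (discrete i) = phase_field n \<beta> \<omega> p (\<lambda>i. \<theta> i + z t (discrete i)) i"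
        using i by (simp add: V v_def discrete_inverse)
      finally show "((\<lambda>s. \<theta> i + z s (discrete i)) has_real_derivative
          phase_field n \<beta> \<omega> p (\<lambda>i. \<theta> i + z t (discrete i)) i) (at t)"
        unfolding has_real_derivative_iff_has_vector_derivative
        by (auto intro!: derivative_eq_intros)
    qed
    show "(\<lambda>i. \<theta> i + z 0 (discrete i)) = \<theta>" by (simp add: z0)
  qed
qed

section \<open>The derivative of the energy along the flow\<close>

text \<open>
  The directional derivative of the energy at \<open>\<theta>\<close> in direction \<open>v\<close>, in the form that the chain rule
  gives.
\<close>
definition energy_slope ::
    "nat \<Rightarrow> real \<Rightarrow> real \<Rightarrow> (nat \<Rightarrow> real) \<Rightarrow> (nat \<Rightarrow> real) \<Rightarrow> (nat \<Rightarrow> real) \<Rightarrow> real" where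
  "energy_slope n \<beta> \<omega> p \<theta> v = (\<Sum>i=1..n. \<Sum>j=1..n.
     weight \<beta> \<omega> p \<theta> i j * (- (\<beta> * sin (phase_diff \<omega> p \<theta> i j))) * (v i - v j))"

text \<open>
  Stated for arbitrary curves, so that it yields both the partial derivatives (curves that move one
  coordinate) and the derivative along a trajectory.
\<close>
lemma energy_has_derivative_along_curve:
  assumes "\<And>i. i \<in> {1..n} \<Longrightarrow> ((\<lambda>s. c s i) has_real_derivative v i) (at t)"
  shows "((\<lambda>s. energy n \<beta> \<omega> p (c s)) has_real_derivative energy_slope n \<beta> \<omega> p (c t) v) (at t)"
  unfolding energy_def energy_slope_def
proof (intro DERIV_sum)
  fix i j assume "i \<in> {1..n}" "j \<in> {1..n}"
  then have "((\<lambda>s. phase_diff \<omega> p (c s) i j) has_real_derivative v i - v j) (at t)"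
    unfolding phase_diff_def by (auto intro!: derivative_eq_intros assms)
  then show "((\<lambda>s. exp (\<beta> * cos (phase_diff \<omega> p (c s) i j))) has_real_derivative
      weight \<beta> \<omega> p (c t) i j * (- (\<beta> * sin (phase_diff \<omega> p (c t) i j))) * (v i - v j)) (at t)"
    unfolding weight_def by (auto intro!: derivative_eq_intros)
qed

text \<open>
  The slope is linear in the direction, and the velocity is the combination of the coordinate
  directions whose coefficients are its entries.
\<close>
lemma flow_deriv_energy:
  "flow_deriv n \<beta> \<omega> p (energy n \<beta> \<omega> p) \<theta> = energy_slope n \<beta> \<omega> p \<theta> (phase_field n \<beta> \<omega> p \<theta>)"
proof -
  let ?F = "phase_field n \<beta> \<omega> p \<theta>"
  let ?g = "\<lambda>i j. weight \<beta> \<omega> p \<theta> i j * (- (\<beta> * sin (phase_diff \<omega> p \<theta> i j)))"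
  have partial: "partial_deriv (energy n \<beta> \<omega> p) \<theta> k = energy_slope n \<beta> \<omega> p \<theta> (\<lambda>i. if i = k then 1 else 0)" for k
  proof -
    have "((\<lambda>s. (\<theta>(k := s)) i) has_real_derivative (if i = k then 1 else 0)) (at (\<theta> k))" for i
      by auto
    then have "((\<lambda>s. energy n \<beta> \<omega> p (\<theta>(k := s))) has_real_derivative
        energy_slope n \<beta> \<omega> p (\<theta>(k := \<theta> k)) (\<lambda>i. if i = k then 1 else 0)) (at (\<theta> k))"
      by (intro energy_has_derivative_along_curve)
    then show ?thesis
      unfolding partial_deriv_def by (simp add: DERIV_imp_deriv)
  qed
  have "flow_deriv n \<beta> \<omega> p (energy n \<beta> \<omega> p) \<theta> = (\<Sum>k=1..n. \<Sum>i=1..n. \<Sum>j=1..n.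
      ?g i j * ((if i = k then ?F k else 0) - (if j = k then ?F k else 0)))"
    unfolding flow_deriv_def partial energy_slope_def sum_distrib_right
    by (intro sum.cong) auto
  also have "\<dots> = (\<Sum>i=1..n. \<Sum>k=1..n. \<Sum>j=1..n.
      ?g i j * ((if i = k then ?F k else 0) - (if j = k then ?F k else 0)))"
    by (rule sum.swap)
  also have "\<dots> = (\<Sum>i=1..n. \<Sum>j=1..n. \<Sum>k=1..n.
      ?g i j * ((if i = k then ?F k else 0) - (if j = k then ?F k else 0)))"
    by (intro sum.cong refl sum.swap)
  also have "\<dots> = energy_slope n \<beta> \<omega> p \<theta> ?F"
    unfolding energy_slope_def
    by (intro sum.cong refl) (simp only: sum_subtractf sum.delta' finite_atLeastAtMost if_True
        flip: sum_distrib_left)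
  finally show ?thesis .
qed

lemma energy_has_flow_deriv_along_trajectory:
  assumes "trajectory n \<beta> \<omega> p x"
  shows "((\<lambda>t. energy n \<beta> \<omega> p (x t)) has_real_derivative
    flow_deriv n \<beta> \<omega> p (energy n \<beta> \<omega> p) (x t)) (at t)"
  unfolding flow_deriv_energy
  using assms by (intro energy_has_derivative_along_curve) (auto simp: trajectory_def)

text \<open>
  Along the trajectory through \<open>\<theta>\<close> the energy has positive derivative at time 0, hence is larger
  shortly afterwards.
\<close>
lemma not_nonincreasing_if_flow_deriv_pos:
  assumes "flow_deriv n \<beta> \<omega> p (energy n \<beta> \<omega> p) \<theta> > 0"
  shows "\<not> nonincreasing_along n \<beta> \<omega> p (energy n \<beta> \<omega> p)"
proof -
  obtain x where x: "trajectory n \<beta> \<omega> p x" "x 0 = \<theta>" by (rule trajectory_exists)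
  have "\<exists>d>0. \<forall>h>0. h < d \<longrightarrow> energy n \<beta> \<omega> p (x 0) < energy n \<beta> \<omega> p (x (0 + h))"
    using assms x by (intro DERIV_pos_inc_right[OF energy_has_flow_deriv_along_trajectory]) auto
  then obtain h where "h > 0" "energy n \<beta> \<omega> p (x 0) < energy n \<beta> \<omega> p (x h)"
    by (metis add_0 field_lbound_gt_zero)
  then have "\<not> antimono (\<lambda>t. energy n \<beta> \<omega> p (x t))"
    by (metis antimonoD less_le_not_le)
  with x show ?thesis by (auto simp: nonincreasing_along_def)
qed

lemma not_nondecreasing_if_flow_deriv_neg:
  assumes "flow_deriv n \<beta> \<omega> p (energy n \<beta> \<omega> p) \<theta> < 0"
  shows "\<not> nondecreasing_along n \<beta> \<omega> p (energy n \<beta> \<omega> p)"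
proof -
  obtain x where x: "trajectory n \<beta> \<omega> p x" "x 0 = \<theta>" by (rule trajectory_exists)
  have "\<exists>d>0. \<forall>h>0. h < d \<longrightarrow> energy n \<beta> \<omega> p (x 0) > energy n \<beta> \<omega> p (x (0 + h))"
    using assms x by (intro DERIV_neg_dec_right[OF energy_has_flow_deriv_along_trajectory]) auto
  then obtain h where "h > 0" "energy n \<beta> \<omega> p (x 0) > energy n \<beta> \<omega> p (x h)"
    by (metis add_0 field_lbound_gt_zero)
  then have "\<not> mono (\<lambda>t. energy n \<beta> \<omega> p (x t))"
    by (metis monoD less_le_not_le)
  with x show ?thesis by (auto simp: nondecreasing_along_def)
qed

section \<open>The two states\<close>

lemma sum_1_to_3: "(\<Sum>i=1..3. f i) = f 1 + f 2 + f (3::nat)"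
  by (simp add: numeral_3_eq_3 numeral_2_eq_2)

lemma triple_nth [simp]: "triple a b c 1 = a" "triple a b c 2 = b" "triple a b c 3 = c"
  by (simp_all add: triple_def)

text \<open>
  Reflecting the phases about \<open>pi/6\<close> and exchanging the outer tokens preserves this state. Hence
  the middle token rests and the outer velocities are opposite. Each of the two neighbour pairs
  contributes \<open>- a F 1\<close> to the derivative and the outer pair \<open>2 sqrt 3 b F 1\<close>; since \<open>a < 1 < b\<close>,
  the outer pair wins.
\<close>
lemma flow_deriv_pos_at_equispaced:
  "flow_deriv 3 1 pi (triple 0 1 2) (energy 3 1 pi (triple 0 1 2)) (triple 0 (pi/6) (pi/3)) > 0"
proof -
  \<comment> \<open>Keeps the index 1 in the form in which the rules below mention it.\<close>
  note One_nat_def [simp del]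
  define \<theta> where "\<theta> = triple 0 (pi/6) (pi/3)"
  define F where "F = phase_field 3 1 pi (triple 0 1 2) \<theta>"
  define a b where "a = exp (- (sqrt 3 / 2))" and "b = exp (1 / 2 :: real)"
  have ab: "0 < a" "a < 1" "1 < b" by (auto simp: a_def b_def)
  have \<theta>: "\<theta> 1 = 0" "\<theta> 2 = pi/6" "\<theta> 3 = pi/3" by (simp_all add: \<theta>_def)
  let ?\<delta> = "phase_diff pi (triple 0 1 2) \<theta>"
  have \<delta>: "?\<delta> 1 2 = - (pi/6 + pi)" "?\<delta> 2 1 = pi/6 + pi" "?\<delta> 2 3 = - (pi/6 + pi)"
      "?\<delta> 3 2 = pi/6 + pi" "?\<delta> 1 3 = - (pi/3 + 2 * pi)" "?\<delta> 3 1 = pi/3 + 2 * pi" "?\<delta> i i = 0" for i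
    by (simp_all add: phase_diff_def \<theta> field_simps)
  have trig: "sin (?\<delta> 1 2) = 1/2" "sin (?\<delta> 2 1) = - (1/2)" "sin (?\<delta> 2 3) = 1/2"
      "sin (?\<delta> 3 2) = - (1/2)" "sin (?\<delta> 1 3) = - (sqrt 3 / 2)" "sin (?\<delta> 3 1) = sqrt 3 / 2"
      "cos (?\<delta> 1 2) = - (sqrt 3 / 2)" "cos (?\<delta> 2 1) = - (sqrt 3 / 2)"
      "cos (?\<delta> 2 3) = - (sqrt 3 / 2)" "cos (?\<delta> 3 2) = - (sqrt 3 / 2)"
      "cos (?\<delta> 1 3) = 1/2" "cos (?\<delta> 3 1) = 1/2" "sin (?\<delta> i i) = 0" "cos (?\<delta> i i) = 1" for i
    unfolding \<delta> sin_minus cos_minus sin_periodic cos_periodic sin_periodic_pi cos_periodic_pi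
      sin_30 cos_30 sin_60 cos_60 by simp_all
  let ?w = "weight 1 pi (triple 0 1 2) \<theta>"
  have w: "?w 1 2 = a" "?w 2 1 = a" "?w 2 3 = a" "?w 3 2 = a" "?w 1 3 = b" "?w 3 1 = b" "?w i i = exp 1" for i
    by (simp_all add: weight_def trig a_def b_def)
  have "sin (pi/3 - pi/6) = sin (pi/6)" "sin (pi/6 - pi/3) = - sin (pi/6)"
    by (simp_all add: sin_diff sin_30 sin_60 cos_30 cos_60)
  then have F: "F 1 = (a / 2 + b * (sqrt 3 / 2)) / (exp 1 + a + b)" "F 2 = 0" "F 3 = - F 1"
    by (simp_all add: F_def phase_field_def attention_def partition_fn_def sum_1_to_3 w sin_30 sin_60 \<theta>
        add_ac add_divide_distrib diff_divide_distrib)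
  have "energy_slope 3 1 pi (triple 0 1 2) \<theta> F = 2 * F 1 * (sqrt 3 * b - a)"
    by (simp add: energy_slope_def sum_1_to_3 w trig F(2,3) algebra_simps)
  moreover have "F 1 > 0" using ab by (simp add: F add_pos_pos)
  moreover have "sqrt 3 * b > a"
    using ab mult_mono[of 1 "sqrt 3" 1 b] by (simp add: real_le_rsqrt)
  ultimately show ?thesis by (simp add: flow_deriv_energy F_def \<theta>_def)
qed

text \<open>
  The two outer phases coincide, so the outer pair contributes nothing and only the neighbours,
  whose attraction lowers the energy, remain.
\<close>
lemma flow_deriv_neg_at_mirror:
  "flow_deriv 3 1 pi (triple 0 1 2) (energy 3 1 pi (triple 0 1 2)) (triple 0 (pi/6) 0) < 0"
proof -
  note One_nat_def [simp del]
  define \<theta> where "\<theta> = triple 0 (pi/6) 0"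
  define F where "F = phase_field 3 1 pi (triple 0 1 2) \<theta>"
  define a where "a = exp (- (sqrt 3 / 2))"
  have "a > 0" by (simp add: a_def)
  have \<theta>: "\<theta> 1 = 0" "\<theta> 2 = pi/6" "\<theta> 3 = 0" by (simp_all add: \<theta>_def)
  let ?\<delta> = "phase_diff pi (triple 0 1 2) \<theta>"
  have \<delta>: "?\<delta> 1 2 = - (pi/6 + pi)" "?\<delta> 2 1 = pi/6 + pi" "?\<delta> 2 3 = - (pi - pi/6)"
      "?\<delta> 3 2 = pi - pi/6" "?\<delta> 1 3 = - (2 * pi)" "?\<delta> 3 1 = 2 * pi" "?\<delta> i i = 0" for i
    by (simp_all add: phase_diff_def \<theta> field_simps)
  have trig: "sin (?\<delta> 1 2) = 1/2" "sin (?\<delta> 2 1) = - (1/2)" "sin (?\<delta> 2 3) = - (1/2)"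
      "sin (?\<delta> 3 2) = 1/2" "sin (?\<delta> 1 3) = 0" "sin (?\<delta> 3 1) = 0"
      "cos (?\<delta> 1 2) = - (sqrt 3 / 2)" "cos (?\<delta> 2 1) = - (sqrt 3 / 2)"
      "cos (?\<delta> 2 3) = - (sqrt 3 / 2)" "cos (?\<delta> 3 2) = - (sqrt 3 / 2)"
      "cos (?\<delta> 1 3) = 1" "cos (?\<delta> 3 1) = 1" "sin (?\<delta> i i) = 0" "cos (?\<delta> i i) = 1" for i
    unfolding \<delta> sin_minus cos_minus sin_periodic_pi cos_periodic_pi sin_pi_minus cos_pi_minus
      sin_30 cos_30 by simp_all
  let ?w = "weight 1 pi (triple 0 1 2) \<theta>"
  have w: "?w 1 2 = a" "?w 2 1 = a" "?w 2 3 = a" "?w 3 2 = a" "?w 1 3 = exp 1" "?w 3 1 = exp 1"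
      "?w i i = exp 1" for i
    by (simp_all add: weight_def trig a_def)
  have F: "F 1 = a / 2 / (2 * exp 1 + a)" "F 2 = - a / (exp 1 + 2 * a)" "F 3 = F 1"
    by (simp_all add: F_def phase_field_def attention_def partition_fn_def sum_1_to_3 w sin_30 \<theta>
        add_ac, simp add: divide_simps)
  have "energy_slope 3 1 pi (triple 0 1 2) \<theta> F = 2 * a * (F 2 - F 1)"
    by (simp add: energy_slope_def sum_1_to_3 w trig F(3) algebra_simps)
  moreover have "F 1 > 0" "F 2 < 0" using \<open>a > 0\<close> by (simp_all add: F add_pos_pos)
  ultimately show ?thesis
    using \<open>a > 0\<close> by (simp add: flow_deriv_energy F_def \<theta>_def mult_pos_neg)
qed

theorem proposition3p2:
  fixes n :: nat and p :: "nat \<Rightarrow> real" and \<beta> \<omega> :: real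
  assumes "n = 3" and "p = triple 0 1 2" and "\<beta> = 1" and "\<omega> = pi"
  shows "flow_deriv n \<beta> \<omega> p (energy n \<beta> \<omega> p) (triple 0 (pi/6) (pi/3)) > 0
    \<and> flow_deriv n \<beta> \<omega> p (energy n \<beta> \<omega> p) (triple 0 (pi/6) 0) < 0
    \<and> \<not> lyapunov_function n \<beta> \<omega> p (energy n \<beta> \<omega> p)
    \<and> \<not> lyapunov_function n \<beta> \<omega> p (\<lambda>\<theta>. - energy n \<beta> \<omega> p \<theta>)
    \<and> \<not> (\<forall>(m::nat) (b::real) (w::real) (q::nat \<Rightarrow> real).
           m \<ge> 2 \<and> b \<ge> 0 \<longrightarrow> nondecreasing_along m b w q (energy m b w q))
    \<and> \<not> (\<forall>(m::nat) (b::real) (w::real) (q::nat \<Rightarrow> real).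
           m \<ge> 2 \<and> b \<ge> 0 \<longrightarrow> nonincreasing_along m b w q (energy m b w q))"
proof -
  have pos: "flow_deriv n \<beta> \<omega> p (energy n \<beta> \<omega> p) (triple 0 (pi/6) (pi/3)) > 0"
    using flow_deriv_pos_at_equispaced by (simp add: assms)
  have neg: "flow_deriv n \<beta> \<omega> p (energy n \<beta> \<omega> p) (triple 0 (pi/6) 0) < 0"
    using flow_deriv_neg_at_mirror by (simp add: assms)
  have not_dec: "\<not> nonincreasing_along n \<beta> \<omega> p (energy n \<beta> \<omega> p)"
    using pos by (rule not_nonincreasing_if_flow_deriv_pos)
  have not_inc: "\<not> nondecreasing_along n \<beta> \<omega> p (energy n \<beta> \<omega> p)"
    using neg by (rule not_nondecreasing_if_flow_deriv_neg)
  then have "\<not> nonincreasing_along n \<beta> \<omega> p (\<lambda>\<theta>. - energy n \<beta> \<omega> p \<theta>)"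
    by (simp add: nonincreasing_along_def nondecreasing_along_def monotone_def)
  moreover have "n \<ge> 2" "\<beta> \<ge> 0" using assms by auto
  ultimately show ?thesis
    using pos neg not_dec not_inc unfolding lyapunov_function_def by blast
qed

end
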